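(* Let $S$ be a finite set and let $\mathcal{X}=(X_1,\dots,X_n)$ be an indexed family of subsets of $S$. A set $T\subseteq S$ is a partial avoiding transversal of $\mathcal{X}$ if and only if for every $J\subseteq\{1,\dots,n\}$ we have \[ |T\cap \mathcal{X}(J)| + |J| \le n. \]
   Context: For $J\subseteq\{1,\dots,n\}$, $\mathcal{X}(J)=\bigcap_{j\in J}X_j$, with the convention $\mathcal{X}(\emptyset)=S$. A partial avoiding transversal of $\mathcal{X}$ is a set $T$ for which there is a subset $K\subseteq\{1,\dots,n\}$ and an enumeration $T=\{x_k : k\in K\}$ by distinct elements with $x_k\notin X_k$ for every $k\in K$ (i.e. there is an injection $\pi:T\to\{1,\dots,n\}$ with $t\notin X_{\pi(t)}$ for all $t\in T$). *)

theory Defs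
  imports Main
begin

definition family_inter :: "'a set \<Rightarrow> (nat \<Rightarrow> 'a set) \<Rightarrow> nat set \<Rightarrow> 'a set" where
  "family_inter S X J = (if J = {} then S else (\<Inter>j\<in>J. X j))"

(* The bijection x is the enumeration of T, indexed by K, by distinct elements x k. *)
definition partial_avoiding_transversal :: "nat \<Rightarrow> (nat \<Rightarrow> 'a set) \<Rightarrow> 'a set \<Rightarrow> bool" where
  "partial_avoiding_transversal n X T \<longleftrightarrow>
     (\<exists>K x. K \<subseteq> {1..n} \<and> bij_betw x K T \<and> (\<forall>k\<in>K. x k \<notin> X k))"

end

theory Submission
  imports Defs
begin

text \<open>A partial avoiding transversal on \<open>T\<close> is the inverse of a system of distinct representatives
  of the sets \<open>A t = {i \<in> {1..n}. t \<notin> X i}\<close>, \<open>t \<in> T\<close>. For \<open>U \<subseteq> T\<close>, the complement of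
  \<open>\<Union>(A ` U)\<close> in \<open>{1..n}\<close> is the set \<open>J\<close> of indices with \<open>U \<subseteq> X j\<close>, so the inequality for
  this \<open>J\<close> is Hall's condition for \<open>U\<close>. Hall's theorem is proved by the argument of Halmos and
  Vaughan: either all Hall inequalities of nonempty proper subfamilies are strict and any one
  representative may be fixed, or the family splits at a tight subfamily.\<close>

theorem Hall_marriage:
  assumes "finite I" "\<And>i. i \<in> I \<Longrightarrow> finite (A i)"
    and "\<And>J. J \<subseteq> I \<Longrightarrow> card J \<le> card (\<Union>(A ` J))"
  shows "\<exists>R. inj_on R I \<and> (\<forall>i\<in>I. R i \<in> A i)"
  using assms
proof (induction I arbitrary: A rule: finite_psubset_induct)
  case (psubset I)
  note fin = psubset.prems(1) and Hall = psubset.prems(2)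
  have fin_UN: "finite (\<Union>(A ` J))" if "J \<subseteq> I" for J
    using that fin finite_subset[OF that psubset.hyps] by (intro finite_UN_I) auto
  show ?case
  proof (cases "\<exists>J. J \<subset> I \<and> J \<noteq> {} \<and> card (\<Union>(A ` J)) = card J")
    case True
    then obtain J where J: "J \<subset> I" "J \<noteq> {}" and tight: "card (\<Union>(A ` J)) = card J"
      by blast
    have "\<exists>R. inj_on R J \<and> (\<forall>i\<in>J. R i \<in> A i)"
    proof (rule psubset.IH[OF J(1)])
      show "finite (A i)" if "i \<in> J" for i using that J fin by blast
      show "card K \<le> card (\<Union>(A ` K))" if "K \<subseteq> J" for K
        using that J Hall[of K] by blast
    qed
    then obtain R where R: "inj_on R J" "\<And>i. i \<in> J \<Longrightarrow> R i \<in> A i" by blast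
    \<comment> \<open>All of \<open>\<Union>(A\<close>
      J)\<open>is removed, not only the values\<close>R \<open>J\<close>: by tightness this deletes
      exactly \<open>card J\<close> elements, and the representatives chosen outside
      \<open>J\<close> cannot clash with those of \<open>R\<close>.\<close>
    define B where "B i = A i - \<Union>(A ` J)" for i
    have "\<exists>Q. inj_on Q (I - J) \<and> (\<forall>i\<in>I - J. Q i \<in> B i)"
    proof (rule psubset.IH)
      show "I - J \<subset> I" using J by blast
      show "finite (B i)" if "i \<in> I - J" for i using that fin by (simp add: B_def)
      fix K assume K: "K \<subseteq> I - J"
      have "K \<union> J \<subseteq> I" using K J by blast
      then have finK: "finite K" "finite J"
        using finite_subset[OF _ psubset.hyps, of "K \<union> J"] by simp_all
      have eq: "\<Union>(A ` (K \<union> J)) = \<Union>(B ` K) \<union> \<Union>(A ` J)"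
        by (auto simp: B_def)
      have disj: "\<Union>(B ` K) \<inter> \<Union>(A ` J) = {}" by (auto simp: B_def)
      have "finite (\<Union>(B ` K))" "finite (\<Union>(A ` J))"
        using fin_UN[OF \<open>K \<union> J \<subseteq> I\<close>] unfolding eq by auto
      \<comment> \<open>Hall's condition passes to \<open>B\<close>: apply it to
        \<open>K \<union> J\<close> in the original family, then cancel \<open>card J\<close>, which
        by tightness is the size of the removed union.\<close>
      have "card K + card J = card (K \<union> J)"
        using K finK by (subst card_Un_disjoint) auto
      also have "\<dots> \<le> card (\<Union>(A ` (K \<union> J)))" by (rule Hall[OF \<open>K \<union> J \<subseteq> I\<close>])
      also have "\<dots> = card (\<Union>(B ` K)) + card J"
        unfolding eq tight[symmetric]
        by (rule card_Un_disjoint) fact+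
      finally show "card K \<le> card (\<Union>(B ` K))" by simp
    qed
    then obtain Q where Q: "inj_on Q (I - J)" "\<And>i. i \<in> I - J \<Longrightarrow> Q i \<in> B i" by blast
    let ?P = "\<lambda>i. if i \<in> J then R i else Q i"
    have sep: "R i \<noteq> Q k" if "i \<in> J" "k \<in> I - J" for i k
      using R(2)[OF that(1)] Q(2)[OF that(2)] that(1) by (auto simp: B_def)
    have "inj_on ?P I"
    proof (rule inj_onI)
      fix i k assume ik: "i \<in> I" "k \<in> I" "?P i = ?P k"
      show "i = k"
        using ik sep[of i k] sep[of k i] inj_onD[OF R(1), of i k] inj_onD[OF Q(1), of i k]
        by (cases "i \<in> J"; cases "k \<in> J") auto
    qed
    moreover have "\<forall>i\<in>I. ?P i \<in> A i" using R(2) Q(2) by (auto simp: B_def)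
    ultimately show ?thesis by blast
  next
    case False
    then have strict: "card K \<noteq> card (\<Union>(A ` K))" if "K \<subset> I" "K \<noteq> {}" for K
      using that by (metis (full_types))
    show ?thesis
    proof (cases "I = {}")
      case True
      then show ?thesis by simp
    next
      case False
      then obtain a where a: "a \<in> I" by blast
      have "A a \<noteq> {}" using Hall[of "{a}"] a by auto
      then obtain x where x: "x \<in> A a" by blast
      \<comment> \<open>Reserving \<open>x\<close> for \<open>a\<close> shrinks each union by at
        most one element, which the strict inequality for nonempty \<open>K \<subset> I\<close> can
        afford.\<close>
      have "\<exists>R. inj_on R (I - {a}) \<and> (\<forall>i\<in>I - {a}. R i \<in> A i - {x})"
      proof (rule psubset.IH[of "I - {a}" "\<lambda>i. A i - {x}"])
        show "I - {a} \<subset> I" using a by blast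
        show "finite (A i - {x})" if "i \<in> I - {a}" for i using that fin by simp
        fix K assume K: "K \<subseteq> I - {a}"
        show "card K \<le> card (\<Union>i\<in>K. A i - {x})"
        proof (cases "K = {}")
          case True
          then show ?thesis by simp
        next
          case ne: False
          have "K \<subset> I" using K a by blast
          then have "card K \<noteq> card (\<Union>(A ` K))" using ne by (rule strict)
          moreover have "card K \<le> card (\<Union>(A ` K))" using \<open>K \<subset> I\<close> Hall by blast
          moreover have "(\<Union>i\<in>K. A i - {x}) = \<Union>(A ` K) - {x}" by blast
          moreover have "card (\<Union>(A ` K)) - 1 \<le> card (\<Union>(A ` K) - {x})"
            using card_Diff_singleton_if[of "\<Union>(A ` K)" x] by simp
          ultimately show ?thesis by simp
        qed
      qed
      then obtain R where R: "inj_on R (I - {a})" "\<And>i. i \<in> I - {a} \<Longrightarrow> R i \<in> A i - {x}" by blast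
      have "x \<notin> R ` (I - {a})" using R(2) by blast
      then have "inj_on (R(a := x)) (insert a (I - {a}))"
        using R(1) by (subst inj_on_insert) (auto simp: inj_on_def)
      then have "inj_on (R(a := x)) I" using a by (simp add: insert_absorb)
      moreover have "\<forall>i\<in>I. (R(a := x)) i \<in> A i" using R(2) x by auto
      ultimately show ?thesis by blast
    qed
  qed
qed

theorem theorem11:
  fixes S T :: "'a set" and X :: "nat \<Rightarrow> 'a set" and n :: nat
  assumes "finite S"
    and "\<And>i. i \<in> {1..n} \<Longrightarrow> X i \<subseteq> S"
    and "T \<subseteq> S"
  shows "partial_avoiding_transversal n X T \<longleftrightarrow>
    (\<forall>J. J \<subseteq> {1..n} \<longrightarrow> card (T \<inter> family_inter S X J) + card J \<le> n)"
proof
  assume "partial_avoiding_transversal n X T"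
  then obtain K x where K: "K \<subseteq> {1..n}" and bij: "bij_betw x K T"
    and avoid: "\<And>k. k \<in> K \<Longrightarrow> x k \<notin> X k"
    unfolding partial_avoiding_transversal_def by blast
  show "\<forall>J. J \<subseteq> {1..n} \<longrightarrow> card (T \<inter> family_inter S X J) + card J \<le> n"
  proof (intro allI impI)
    fix J assume J: "J \<subseteq> {1..n}"
    \<comment> \<open>\<open>L\<close> indexes the elements of \<open>T\<close> counted on the left.
      An index in both \<open>L\<close> and \<open>J\<close> would give
      \<open>x k \<in> X k\<close>, so \<open>L\<close> and \<open>J\<close> are disjoint inside
      \<open>{1..n}\<close> and their sizes add up to at most \<open>n\<close>.\<close>
    define L where "L = {k \<in> K. x k \<in> family_inter S X J}"
    have "x ` L = T \<inter> family_inter S X J"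
      using bij by (auto simp: L_def bij_betw_def)
    moreover have "inj_on x L"
      using bij by (auto simp: L_def bij_betw_def inj_on_def)
    ultimately have "card (T \<inter> family_inter S X J) = card L"
      using card_image by metis
    moreover have "L \<inter> J = {}"
      using avoid by (auto simp: L_def family_inter_def split: if_splits)
    moreover have "L \<union> J \<subseteq> {1..n}" using K J by (auto simp: L_def)
    moreover from this have "finite L" "finite J"
      using finite_subset[of "L \<union> J" "{1..n}"] by simp_all
    moreover have "card (L \<union> J) \<le> card {1..n}"
      using \<open>L \<union> J \<subseteq> {1..n}\<close> by (intro card_mono) simp_all
    ultimately show "card (T \<inter> family_inter S X J) + card J \<le> n"
      by (simp add: card_Un_disjoint)
  qed
next
  assume ineq: "\<forall>J. J \<subseteq> {1..n} \<longrightarrow> card (T \<inter> family_inter S X J) + card J \<le> n"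
  have "finite T" using assms finite_subset by blast
  define A where "A t = {i \<in> {1..n}. t \<notin> X i}" for t
  have "\<exists>R. inj_on R T \<and> (\<forall>t\<in>T. R t \<in> A t)"
  proof (rule Hall_marriage[OF \<open>finite T\<close>])
    show "finite (A t)" for t by (simp add: A_def)
    fix U assume U: "U \<subseteq> T"
    define J where "J = {1..n} - \<Union>(A ` U)"
    have "\<Union>(A ` U) \<subseteq> {1..n}" by (auto simp: A_def)
    \<comment> \<open>The second bound ensures that the subtraction on naturals is not
      truncated.\<close>
    then have "card J = n - card (\<Union>(A ` U))" "card (\<Union>(A ` U)) \<le> n"
      using card_Diff_subset[OF finite_subset, of "\<Union>(A ` U)" "{1..n}" "{1..n}"]
        card_mono[of "{1..n}" "\<Union>(A ` U)"]
      by (simp_all add: J_def)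
    \<comment> \<open>An index outside every \<open>A t\<close> with \<open>t \<in> U\<close> has
      \<open>U \<subseteq> X j\<close>. If \<open>J\<close> is empty, the convention makes the
      intersection \<open>S\<close>, and \<open>T \<subseteq> S\<close> is what is used.\<close>
    moreover have "U \<subseteq> T \<inter> family_inter S X J"
      using U assms(3) by (auto simp: family_inter_def J_def A_def)
    then have "card U \<le> card (T \<inter> family_inter S X J)"
      using \<open>finite T\<close> by (intro card_mono) auto
    moreover have "card (T \<inter> family_inter S X J) + card J \<le> n"
      using ineq by (simp add: J_def)
    ultimately show "card U \<le> card (\<Union>(A ` U))" by linarith
  qed
  then obtain R where R: "inj_on R T" "\<And>t. t \<in> T \<Longrightarrow> R t \<in> A t" by blast
  have "R ` T \<subseteq> {1..n}" using R(2) by (auto simp: A_def)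
  moreover have "bij_betw (inv_into T R) (R ` T) T"
    using R(1) by (simp add: bij_betw_inv_into inj_on_imp_bij_betw)
  moreover have "\<forall>k\<in>R ` T. inv_into T R k \<notin> X k"
    using R by (auto simp: A_def)
  ultimately show "partial_avoiding_transversal n X T"
    unfolding partial_avoiding_transversal_def by blast
qed

end
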